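(* Let $M$ be a finite set of prime numbers and let $a$ be an integer with $a\not\equiv 0\pmod{p_i}$ for every $p_i\in M$. Then there are exactly $$\prod_{p_i\in M,\ p_i\ne 2}(p_i-2)$$ integers $x$ in $P_M$ such that $x-a$ and $x+a$ (taken modulo $\prod_{p_i\in M}p_i$) are both $M$-primes.
   Context: For a set $M$ of prime numbers, an $M$-prime is an integer not divisible by any of the primes in $M$. $P_M=\{x\in\mathbb{Z}: 0\le x<\prod_{p_i\in M}p_i\}$. An empty product equals $1$. *)

theory Defs
  imports "HOL-Number_Theory.Cong"
begin

definition M_prime :: "nat set \<Rightarrow> int \<Rightarrow> bool" where
  "M_prime M x \<longleftrightarrow> (\<forall>p\<in>M. \<not> int p dvd x)"

definition modulus :: "nat set \<Rightarrow> int" where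
  "modulus M = (\<Prod>p\<in>M. int p)"

definition P_set :: "nat set \<Rightarrow> int set" where
  "P_set M = {x. 0 \<le> x \<and> x < modulus M}"

end

theory Submission
  imports Defs
begin

text \<open>
  For \<open>x\<close> in the residue system, both conditions depend only on \<open>x\<close> modulo each \<open>p \<in> M\<close>: the
  residue must avoid \<open>a\<close> and \<open>-a\<close>. These two classes coincide exactly when \<open>p\<close> divides \<open>2 a\<close>,
  that is when \<open>p = 2\<close>. The Chinese remainder theorem multiplies the local counts.
\<close>

text \<open>By the Chinese remainder theorem, \<open>x \<mapsto> (x mod m, x mod n)\<close> is
  injective on \<open>{0..<m * n}\<close>, and it maps the selected residues onto
  \<open>A \<times> B\<close>.\<close>

lemma card_residue_conditions_mult:
  fixes m n :: int
  assumes "m > 0" "n > 0" "coprime m n" "A \<subseteq> {0..<m}" "B \<subseteq> {0..<n}"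
  shows "card {x \<in> {0..<m * n}. x mod m \<in> A \<and> x mod n \<in> B} = card A * card B"
proof -
  let ?S = "{x \<in> {0..<m * n}. x mod m \<in> A \<and> x mod n \<in> B}"
  let ?f = "\<lambda>x. (x mod m, x mod n)"
  have "inj_on ?f ?S"
  proof (rule inj_onI)
    fix x y assume x: "x \<in> ?S" and y: "y \<in> ?S" and "?f x = ?f y"
    then have "[x = y] (mod m)" "[x = y] (mod n)"
      by (auto simp: cong_def)
    then have "[x = y] (mod m * n)"
      using assms(3) by (rule coprime_cong_mult)
    with x y show "x = y"
      by (simp add: cong_def)
  qed
  moreover have "?f ` ?S = A \<times> B"
  proof
    show "A \<times> B \<subseteq> ?f ` ?S"
    proof safe
      fix u v assume u: "u \<in> A" and v: "v \<in> B"
      obtain z where z: "[z = u] (mod m)" "[z = v] (mod n)"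
        using binary_chinese_remainder_int[OF assms(3)] by blast
      have "u mod m = u" "v mod n = v"
        using u v assms(4,5) by (auto simp: subset_iff)
      \<comment> \<open>The solution \<open>z\<close> may lie outside the range. Reducing it modulo
        \<open>m * n\<close> keeps both residues, because \<open>m\<close> and \<open>n\<close>
        divide \<open>m * n\<close>.\<close>
      with z have "z mod (m * n) mod m = u" "z mod (m * n) mod n = v"
        by (simp_all add: cong_def mod_mod_cancel)
      with u v assms(1,2) show "(u, v) \<in> ?f ` ?S"
        by (intro image_eqI[of _ _ "z mod (m * n)"]) auto
    qed
  qed auto
  ultimately have "card ?S = card (A \<times> B)"
    using bij_betw_same_card[of ?f ?S "A \<times> B"] by (simp only: bij_betw_def simp_thms)
  then show ?thesis
    by (simp add: card_cartesian_product)
qed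

lemma card_residues_avoiding_pair:
  fixes p :: nat and a :: int
  assumes "prime p" "\<not> int p dvd a"
  shows "int (card {x \<in> {0..<int p}. \<not> int p dvd x - a \<and> \<not> int p dvd x + a})
         = (if p = 2 then 1 else int p - 2)"
proof -
  let ?p = "int p"
  have p: "?p > 0" "prime ?p"
    using assms(1) by (auto simp: prime_gt_0_nat)
  have avoid: "\<not> ?p dvd x - a \<longleftrightarrow> x \<noteq> a mod ?p"
              "\<not> ?p dvd x + a \<longleftrightarrow> x \<noteq> (- a) mod ?p" if "x \<in> {0..<?p}" for x
    using that mod_eq_dvd_iff[of x ?p a] mod_eq_dvd_iff[of x ?p "-a"] by auto
  then have set_eq: "{x \<in> {0..<?p}. \<not> ?p dvd x - a \<and> \<not> ?p dvd x + a}
    = {0..<?p} - {a mod ?p, (- a) mod ?p}"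
    by blast
  have "card {a mod ?p, (- a) mod ?p} = (if p = 2 then 1 else 2)"
  proof -
    have "a mod ?p = (- a) mod ?p \<longleftrightarrow> ?p dvd 2 * a"
      using mod_eq_dvd_iff[of a ?p "-a"] by simp
    \<comment> \<open>A prime dividing \<open>2 * a\<close> divides one of the factors, and
      \<open>a\<close> is excluded by hypothesis.\<close>
    also have "\<dots> \<longleftrightarrow> ?p dvd 2"
      using p(2) assms(2) by (simp add: prime_dvd_mult_iff)
    also have "\<dots> \<longleftrightarrow> p = 2"
      using assms(1) primes_dvd_imp_eq[OF assms(1) two_is_prime_nat]
      by (metis dvd_refl int_dvd_int_iff of_nat_numeral)
    finally show ?thesis
      by (auto simp: card_insert_if)
  qed
  \<comment> \<open>This bound keeps the subtraction of cardinalities from truncating at 0, so it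
    can be carried over to the integers.\<close>
  moreover have "p \<ge> 2"
    using assms(1) by (rule prime_ge_2_nat)
  moreover have "{a mod ?p, (- a) mod ?p} \<subseteq> {0..<?p}"
    using p(1) by auto
  ultimately show ?thesis
    unfolding set_eq by (simp add: card_Diff_subset of_nat_diff)
qed

theorem mainTheorem11:
  fixes M :: "nat set" and a :: int
  assumes "finite M"
    and "\<And>p. p \<in> M \<Longrightarrow> prime p"
    and "\<And>p. p \<in> M \<Longrightarrow> \<not> [a = 0] (mod int p)"
  shows "int (card {x \<in> P_set M. M_prime M ((x - a) mod modulus M) \<and>
                                 M_prime M ((x + a) mod modulus M)})
         = (\<Prod>p\<in>M - {2}. (int p - 2))"
proof -
  \<comment> \<open>The set of primes is a parameter, so that induction can vary it while
    \<open>a\<close> stays fixed. The reduction of \<open>x - a\<close> and \<open>x + a\<close> is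
    dropped: every \<open>p\<close> in \<open>K\<close> divides \<open>modulus K\<close> when
    \<open>K\<close> is finite, so it does not affect divisibility by \<open>p\<close>.\<close>
  define L where "L K = {x \<in> {0..<modulus K}. \<forall>p\<in>K. \<not> int p dvd x - a \<and> \<not> int p dvd x + a}" for K
  have dvd_modulus: "int p dvd modulus K" if "finite K" "p \<in> K" for p K
    unfolding modulus_def using that by (rule dvd_prodI)
  have "{x \<in> P_set M. M_prime M ((x - a) mod modulus M) \<and> M_prime M ((x + a) mod modulus M)} = L M"
    using dvd_modulus[OF assms(1)] by (auto simp: L_def P_set_def M_prime_def dvd_mod_iff)
  \<comment> \<open>Giving the prime 2 its true local count 1 lets every induction step contribute
    one factor, whether or not the new prime is 2.\<close>
  moreover have "int (card (L M)) = (\<Prod>p\<in>M. if p = 2 then 1 else int p - 2)"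
    using assms
  proof (induction M rule: finite_induct)
    case empty
    \<comment> \<open>The empty modulus is 1, so 0 is the only residue and the conditions are
      vacuous.\<close>
    have "L {} = {0}"
      by (auto simp: L_def modulus_def)
    then show ?case by simp
  next
    case (insert p M)
    let ?A = "{x \<in> {0..<int p}. \<not> int p dvd x - a \<and> \<not> int p dvd x + a}"
    have "prime p" "\<not> int p dvd a"
      using insert.prems by (auto simp: cong_0_iff)
    have pos: "int p > 0" "modulus M > 0"
      using insert.prems(1) by (auto simp: modulus_def prime_gt_0_nat intro!: prod_pos)
    have coprime: "coprime (int p) (modulus M)"
      unfolding modulus_def using insert.prems(1) insert.hyps(2)
      by (intro prod_coprime_right) (auto intro!: primes_coprime)
    have modulus_insert: "modulus (insert p M) = int p * modulus M"
      using insert.hyps by (simp add: modulus_def)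
    \<comment> \<open>Used with \<open>m = int p\<close> for the new prime and with
      \<open>m = modulus M\<close> for the old ones: the conditions on \<open>x\<close> become
      separate conditions on its two residues.\<close>
    have periodic: "int q dvd x mod m - a \<longleftrightarrow> int q dvd x - a"
                   "int q dvd x mod m + a \<longleftrightarrow> int q dvd x + a" if "int q dvd m" for q m x
    proof -
      have "x mod m mod int q = x mod int q"
        using that by (rule mod_mod_cancel)
      then show "int q dvd x mod m - a \<longleftrightarrow> int q dvd x - a"
                "int q dvd x mod m + a \<longleftrightarrow> int q dvd x + a"
        by (metis dvd_eq_mod_eq_0 mod_diff_left_eq, metis dvd_eq_mod_eq_0 mod_add_left_eq)
    qed
    have L_insert: "L (insert p M) = {x \<in> {0..<int p * modulus M}. x mod int p \<in> ?A \<and> x mod modulus M \<in> L M}"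
      using pos dvd_modulus[OF insert.hyps(1)]
      by (auto simp: L_def modulus_insert periodic)
    have "card (L (insert p M)) = card ?A * card (L M)"
      unfolding L_insert
      by (rule card_residue_conditions_mult[OF pos coprime]) (auto simp: L_def)
    then have "int (card (L (insert p M))) = int (card ?A) * int (card (L M))"
      by simp
    also have "int (card (L M)) = (\<Prod>p\<in>M. if p = 2 then 1 else int p - 2)"
      using insert.prems by (intro insert.IH) blast+
    finally show ?case
      unfolding card_residues_avoiding_pair[OF \<open>prime p\<close> \<open>\<not> int p dvd a\<close>]
      by (simp only: prod.insert[OF insert.hyps])
  qed
  moreover have "(\<Prod>p\<in>M. if p = 2 then 1 else int p - 2) = (\<Prod>p\<in>M - {2}. int p - 2)"
    using assms(1) by (intro prod.mono_neutral_cong_right) auto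
  ultimately show ?thesis by simp
qed

end
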